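(* Let $f=(f_1,\dots,f_d):[0,1)^d\to\mathbb{R}^d$ be the dynamical law of a one-dimensional system with $(\chi,g)$-algebraically decaying interactions and separation rank $N$, and suppose that $\chi>1$. Then, for $\varepsilon>0$, there exists for each $k\in[d]$ an $\varepsilon$-approximate tensor train (TT) representation of $f_k$, i.e. a function $\tilde f_k$ with $\|f_k-\tilde f_k\|_2\le\varepsilon$ that admits a TT representation, with rank $$r\le N\left[\left(\frac{\chi}{\chi-1}\,\frac{g}{\varepsilon}\right)^{\frac{1}{\chi-1}}-1\right].$$
   Context: Notation: $[n]=\{1,\dots,n\}$; $\|\cdot\|_2$ is the $L^2$ norm on $[0,1)^d$. A dynamical law is a function $f:\mathcal{S}\to\mathbb{R}^d$ on a state space $\mathcal{S}\subset\mathbb{R}^d$, generating the time evolution by $\dot x(t)=f(x(t))$ or $\ddot x(t)=f(x(t))$; here $\mathcal{S}=[0,1)^d$. Separation rank: the separation rank of a function $h$ with respect to a bipartition of its variables into two groups $u,v$ is the smallest $s$ such that $h(u,v)=\sum_{m=1}^{s}g^{\mathrm{left}}_m(u)\,g^{\mathrm{right}}_m(v)$ for some functions $g^{\mathrm{left}}_m,g^{\mathrm{right}}_m$. One-dimensional system with $(\chi,g)$-algebraically decaying interactions and separation rank $N$: a system governed by a dynamical law $f:[0,1)^d\to\mathbb{R}^d$ for which there is a function set $\{g_{k,L}\}_{k,L\in[d]}$ such that $f_k(x)=\sum_{L\in[d]}L^{-\chi}g_{k,L}(x)$ for all $k$, and for all $k,L\in[d]$: (i) $g_{k,L}$ depends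 non-trivially only on the variables $x_i$ with $i\in[k-L,k+L]$ (indices outside $[d]$ are ignored); (ii) $\|g_{k,L}\|_2\le g$; (iii) $g_{k,L}$ has separation rank at most $N$ with respect to the bipartitions $\{\{x_{k-L},\dots,x_\ell\},\{x_{\ell+1},\dots,x_{k+L}\}\}$ for all $\ell\in\{k-L,\dots,k+L\}$. TT representation: fix a function dictionary, i.e. finitely many linearly independent univariate functions $\Psi_1,\dots,\Psi_p$, and let $\mathcal{A}$ be the span of the products $\Phi_{i_1,\dots,i_d}(x)=\Psi_{i_1}(x_1)\cdots\Psi_{i_d}(x_d)$. It is assumed that the dictionary is chosen so that the functions $g_{k,L}$ (hence all $f_k$) lie in $\mathcal{A}$. A function $h\in\mathcal{A}$, $h=\sum_{i_1,\dots,i_d\in[p]}\Theta_{i_1,\dots,i_d}\Phi_{i_1,\dots,i_d}$, admits a TT representation with ranks $r_1,\dots,r_{d-1}$ if $$\Theta_{i_1,\dots,i_d}=\sum_{j_1\in[r_1],\dots,j_{d-1}\in[r_{d-1}]}(C_1)^{i_1}_{j_1}(C_2)^{i_2}_{j_1,j_2}\cdots(C_d)^{i_d}_{j_{d-1}}$$ for some real tensors $C_1,\dots,C_d$. The rank of such a representation is $r=\max_{\ell\in[d-1]}r_\ell$.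
   Formalization: The bracket in the rank bound is rounded up to the next integer (and to 0 if negative): r ≤ N·max(0, ⌈(χ/(χ−1)·g/ε)^{1/(χ−1)} − 1⌉); without rounding, the printed bound fails, e.g. d=2, N=g=1, χ=2, all g_{k,L}=1, ε=1.1. *)

theory Defs
  imports "HOL-Analysis.Analysis" "HOL-Library.Extended_Nat"
begin

text \<open>
  Points of $[0,1)^d$ are extensional functions on the index set \<open>{1..d}\<close>.
\<close>

definition cube :: "nat \<Rightarrow> (nat \<Rightarrow> real) set" where
  "cube d = {1..d} \<rightarrow>\<^sub>E {0..<1}"

text \<open>
  The Lebesgue measure on the cube; the completion makes all Lebesgue measurable
  (not only Borel measurable) functions admissible.
\<close>

definition cube_measure :: "nat \<Rightarrow> (nat \<Rightarrow> real) measure" where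
  "cube_measure d = completion (\<Pi>\<^sub>M i\<in>{1..d}. restrict_space lborel {0..<1})"

text \<open>
  The Bochner integral of a non-integrable function is \<open>0\<close>, so a bound on \<open>L2_norm\<close> is
  meaningful only together with \<open>square_integrable\<close>.
\<close>

definition square_integrable :: "nat \<Rightarrow> ((nat \<Rightarrow> real) \<Rightarrow> real) \<Rightarrow> bool" where
  "square_integrable d h \<longleftrightarrow>
     h \<in> borel_measurable (cube_measure d) \<and> integrable (cube_measure d) (\<lambda>x. (h x)\<^sup>2)"

definition L2_norm :: "nat \<Rightarrow> ((nat \<Rightarrow> real) \<Rightarrow> real) \<Rightarrow> real" where
  "L2_norm d h = sqrt (\<integral>x. (h x)\<^sup>2 \<partial>cube_measure d)"

definition depends_only_on :: "nat \<Rightarrow> nat set \<Rightarrow> ((nat \<Rightarrow> real) \<Rightarrow> real) \<Rightarrow> bool" where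
  "depends_only_on d W h \<longleftrightarrow>
     (\<forall>x\<in>cube d. \<forall>y\<in>cube d. (\<forall>i\<in>W. x i = y i) \<longrightarrow> h x = h y)"

text \<open>
  \<open>U\<close> and \<open>V\<close> are the two groups of variables. The separation rank is \<open>\<infinity>\<close>
  (the infimum of the empty set) if there is no finite separated representation.
\<close>

definition separated_sum ::
  "nat \<Rightarrow> nat set \<Rightarrow> nat set \<Rightarrow> ((nat \<Rightarrow> real) \<Rightarrow> real) \<Rightarrow> nat \<Rightarrow> bool" where
  "separated_sum d U V h s \<longleftrightarrow>
     (\<exists>gl gr :: nat \<Rightarrow> (nat \<Rightarrow> real) \<Rightarrow> real.
        \<forall>x\<in>cube d. h x = (\<Sum>m\<in>{1..s}. gl m (restrict x U) * gr m (restrict x V)))"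

definition separation_rank ::
  "nat \<Rightarrow> nat set \<Rightarrow> nat set \<Rightarrow> ((nat \<Rightarrow> real) \<Rightarrow> real) \<Rightarrow> enat" where
  "separation_rank d U V h = (INF s\<in>{s. separated_sum d U V h s}. enat s)"

text \<open>
  \<open>\<alpha>\<close> is the decay exponent $\chi$. \<open>f x k\<close> is the \<open>k\<close>-th component of the law at \<open>x\<close>, and \<open>G k L\<close> is the interaction of
  range \<open>L\<close> in that component. Truncated subtraction in \<open>k - L\<close> is harmless: indices below
  \<open>1\<close> are discarded anyway, and all integer cuts \<open>l \<le> 0\<close> yield the same bipartition as \<open>l = 0\<close>.
\<close>

definition algebraically_decaying ::
  "nat \<Rightarrow> real \<Rightarrow> real \<Rightarrow> nat \<Rightarrow> ((nat \<Rightarrow> real) \<Rightarrow> nat \<Rightarrow> real) \<Rightarrow>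
   (nat \<Rightarrow> nat \<Rightarrow> (nat \<Rightarrow> real) \<Rightarrow> real) \<Rightarrow> bool" where
  "algebraically_decaying d \<alpha> g N f G \<longleftrightarrow>
     (\<forall>k\<in>{1..d}. \<forall>x\<in>cube d. f x k = (\<Sum>L\<in>{1..d}. real L powr (- \<alpha>) * G k L x)) \<and>
     (\<forall>k\<in>{1..d}. \<forall>L\<in>{1..d}.
        depends_only_on d ({k - L..k + L} \<inter> {1..d}) (G k L) \<and>
        square_integrable d (G k L) \<and> L2_norm d (G k L) \<le> g \<and>
        (\<forall>l\<in>{k - L..k + L}.
           separation_rank d ({k - L..l} \<inter> {1..d}) ({l + 1..k + L} \<inter> {1..d}) (G k L)
             \<le> enat N))"

definition dictionary :: "nat \<Rightarrow> (nat \<Rightarrow> real \<Rightarrow> real) \<Rightarrow> bool" where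
  "dictionary p \<Psi> \<longleftrightarrow>
     (\<forall>c. (\<forall>t\<in>{0..<1}. (\<Sum>i\<in>{1..p}. c i * \<Psi> i t) = 0) \<longrightarrow> (\<forall>i\<in>{1..p}. c i = 0))"

definition multi_indices :: "nat \<Rightarrow> nat \<Rightarrow> (nat \<Rightarrow> nat) set" where
  "multi_indices d p = {1..d} \<rightarrow>\<^sub>E {1..p}"

definition product_function ::
  "nat \<Rightarrow> (nat \<Rightarrow> real \<Rightarrow> real) \<Rightarrow> (nat \<Rightarrow> nat) \<Rightarrow> (nat \<Rightarrow> real) \<Rightarrow> real" where
  "product_function d \<Psi> I x = (\<Prod>l\<in>{1..d}. \<Psi> (I l) (x l))"

definition has_coefficients ::
  "nat \<Rightarrow> nat \<Rightarrow> (nat \<Rightarrow> real \<Rightarrow> real) \<Rightarrow> ((nat \<Rightarrow> real) \<Rightarrow> real) \<Rightarrow>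
   ((nat \<Rightarrow> nat) \<Rightarrow> real) \<Rightarrow> bool" where
  "has_coefficients d p \<Psi> h \<Theta> \<longleftrightarrow>
     (\<forall>x\<in>cube d. h x = (\<Sum>I\<in>multi_indices d p. \<Theta> I * product_function d \<Psi> I x))"

definition in_ansatz_space ::
  "nat \<Rightarrow> nat \<Rightarrow> (nat \<Rightarrow> real \<Rightarrow> real) \<Rightarrow> ((nat \<Rightarrow> real) \<Rightarrow> real) \<Rightarrow> bool" where
  "in_ansatz_space d p \<Psi> h \<longleftrightarrow> (\<exists>\<Theta>. has_coefficients d p \<Psi> h \<Theta>)"

text \<open>
  All cores get a left and a right bond index; the first core's left and the last core's
  right index range over \<open>{1}\<close>, so that these cores effectively have only one bond index
  (and none if \<open>d = 1\<close>). A rank may be \<open>0\<close>, in which case the contraction is \<open>0\<close>.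
\<close>

definition bond_indices :: "nat \<Rightarrow> (nat \<Rightarrow> nat) \<Rightarrow> (nat \<Rightarrow> nat) set" where
  "bond_indices d r = (\<Pi>\<^sub>E l\<in>{0..d}. if l \<in> {1..<d} then {1..r l} else {1})"

definition tt_contraction ::
  "nat \<Rightarrow> (nat \<Rightarrow> nat) \<Rightarrow> (nat \<Rightarrow> nat \<Rightarrow> nat \<Rightarrow> nat \<Rightarrow> real) \<Rightarrow> (nat \<Rightarrow> nat) \<Rightarrow> real" where
  "tt_contraction d r C I =
     (\<Sum>J\<in>bond_indices d r. \<Prod>l\<in>{1..d}. C l (I l) (J (l - 1)) (J l))"

definition admits_TT ::
  "nat \<Rightarrow> nat \<Rightarrow> (nat \<Rightarrow> real \<Rightarrow> real) \<Rightarrow> ((nat \<Rightarrow> real) \<Rightarrow> real) \<Rightarrow> (nat \<Rightarrow> nat) \<Rightarrow> bool" where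
  "admits_TT d p \<Psi> h r \<longleftrightarrow>
     (\<exists>\<Theta> C. has_coefficients d p \<Psi> h \<Theta> \<and>
            (\<forall>I\<in>multi_indices d p. \<Theta> I = tt_contraction d r C I))"

text \<open>The inserted \<open>0\<close> only matters for \<open>d \<le> 1\<close>, where there are no ranks.\<close>

definition tt_rank :: "nat \<Rightarrow> (nat \<Rightarrow> nat) \<Rightarrow> nat" where
  "tt_rank d r = Max (insert 0 (r ` {1..<d}))"

end

theory Submission
  imports Defs
begin

text \<open>
  Cut the interaction series of \<open>f\<^sub>k\<close> off at the range \<open>R\<close> with \<open>R + 1 \<ge> X\<close>, where \<open>X\<close> is the
  \<open>1 / (\<alpha> - 1)\<close>-th power of \<open>\<alpha> / (\<alpha> - 1) \<cdot> g / \<epsilon>\<close>. The discarded part has norm at most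
  \<open>g \<cdot> \<Sum>\<^sub>L L\<^sup>-\<^sup>\<alpha>\<close> with \<open>L\<close> running from \<open>R + 1\<close>, and comparing this sum with an integral bounds it by
  \<open>g \<cdot> \<alpha> / (\<alpha> - 1) \<cdot> (R + 1)\<^sup>1\<^sup>-\<^sup>\<alpha> \<le> \<epsilon>\<close> (\<open>cutoff_error\<close>).

  The part that is kept has at most \<open>R\<close> terms. Each of them is a sum of \<open>N\<close> products with respect
  to every cut of the chain of variables into a left and a right piece: for a cut inside the window
  of the interaction this is the hypothesis on the separation rank, and for a cut outside the window
  the interaction sees only one side, so that a single product suffices
  (\<open>interaction_cut_separable\<close>). Hence the truncated law is a sum of \<open>N \<cdot> R\<close> products at every cut.

  It remains to pass from separability at each single cut to one tensor train that realises all these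
  ranks at once (\<open>separable_cuts_imp_admits_TT\<close>). The separated sums of different cuts are
  unrelated to each other, so they are first normalised: at each cut the left factors can be
  taken in the span of the columns of \<open>h\<close>, seen as a matrix whose rows are indexed by the left
  variables and whose columns by the right ones, and the right factors in the span of its rows,
  without more terms (\<open>skeleton_decomposition\<close>). Then
  a right factor at the cut \<open>l\<close>, being a combination of partial evaluations of \<open>h\<close>, can be expanded
  in the right factors at the cut \<open>l + 1\<close>, and the expansion coefficients are functions of the
  variable \<open>x\<^sub>l\<^sub>+\<^sub>1\<close> alone. These coefficients are the core number \<open>l + 1\<close>; they lie in the span of the
  dictionary because the left factors are combinations of columns and \<open>h\<close> itself is, in each single
  variable, a combination of dictionary functions (\<open>row_span_transfer\<close>). Chaining the expansions from
  \<open>l = 0\<close> to \<open>l = d\<close> gives the train.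
\<close>

section \<open>Factorisations through rows and columns\<close>

inductive_set lin_span :: "('a \<Rightarrow> real) set \<Rightarrow> ('a \<Rightarrow> real) set" for U where
  base: "u \<in> U \<Longrightarrow> u \<in> lin_span U"
| zero: "(\<lambda>_. 0) \<in> lin_span U"
| comb: "u \<in> lin_span U \<Longrightarrow> v \<in> lin_span U \<Longrightarrow> (\<lambda>x. u x + c * v x) \<in> lin_span U"

lemma lin_span_minimal:
  assumes "u \<in> lin_span U" and "U \<subseteq> lin_span V"
  shows "u \<in> lin_span V"
  using assms by (induction rule: lin_span.induct) (auto intro: lin_span.intros)

text \<open>
  This is Wedderburn rank reduction. Subtracting from \<open>F\<close> the cross
  \<open>F x y0 * F x0 y / F x0 y0\<close> through a nonzero entry changes rows and columns only within their
  spans and produces a remainder that vanishes on the column \<open>y0\<close>. This vanishing is a linear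
  relation between the left factors of the remainder, with coefficients \<open>b m y0\<close> that are not all
  zero as \<open>F x0 y0 \<noteq> 0\<close>. It permits to eliminate one of them, so
  the remainder has one summand less. Iterating writes \<open>F\<close> as a sum of
  crosses, and there are not more of them than summands in the given representation.
\<close>

lemma skeleton_decomposition:
  fixes F :: "'a \<Rightarrow> 'b \<Rightarrow> real"
  assumes "finite S"
    and "\<And>x y. x \<in> X \<Longrightarrow> y \<in> Y \<Longrightarrow> F x y = (\<Sum>m\<in>S. a m x * b m y)"
  shows "\<exists>A B. (\<forall>x\<in>X. \<forall>y\<in>Y. F x y = (\<Sum>m\<in>S. A m x * B m y)) \<and>
           (\<forall>m\<in>S. A m \<in> lin_span ((\<lambda>y x. F x y) ` Y)) \<and> (\<forall>m\<in>S. B m \<in> lin_span (F ` X))"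
  using assms
proof (induction S arbitrary: F a b rule: finite_psubset_induct)
  case (psubset S)
  show ?case
  proof (cases "\<forall>x\<in>X. \<forall>y\<in>Y. F x y = 0")
    case True
    then show ?thesis
      by (intro exI[of _ "\<lambda>_ _. 0"]) (auto intro: lin_span.zero)
  next
    case False
    then obtain x0 y0 where x0: "x0 \<in> X" and y0: "y0 \<in> Y" and nz: "F x0 y0 \<noteq> 0" by blast
    define q where "q = F x0 y0"
    have q: "q \<noteq> 0" using nz q_def by simp
    have "(\<Sum>m\<in>S. a m x0 * b m y0) \<noteq> 0" using psubset.prems[OF x0 y0] nz by simp
    then obtain j where j: "j \<in> S" and bj: "b j y0 \<noteq> 0"
      by (auto elim: sum.not_neutral_contains_not_neutral)
    \<comment> \<open>The remainder after subtracting the cross, with left factors adapted to it; the new right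
      factors absorb the eliminated left factor \<open>a' j\<close>.\<close>
    define F' where "F' = (\<lambda>x y. F x y - F x y0 * F x0 y / q)"
    define a' where "a' = (\<lambda>m x. a m x - F x y0 / q * a m x0)"
    define b' where "b' = (\<lambda>m y. b m y - b m y0 / b j y0 * b j y)"
    define T where "T = S - {j}"
    have fin: "finite S" by fact
    have T: "T \<subset> S" using j T_def by auto
    have split: "(\<Sum>m\<in>S. h m) = h j + (\<Sum>m\<in>T. h m)" for h :: "'c \<Rightarrow> real"
      unfolding T_def by (rule sum.remove[OF fin j])
    have F'_S: "F' x y = (\<Sum>m\<in>S. a' m x * b m y)" if "x \<in> X" "y \<in> Y" for x y
      using psubset.prems[OF that] psubset.prems[OF x0 that(2)]
      by (simp add: F'_def a'_def left_diff_distrib sum_subtractf sum_distrib_left mult.assoc)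
         (simp add: divide_inverse mult_ac sum_distrib_left)
    have F'_T: "F' x y = (\<Sum>m\<in>T. a' m x * b' m y)" if x: "x \<in> X" and y: "y \<in> Y" for x y
    proof -
      have "F' x y0 = 0" unfolding F'_def using q by (simp add: q_def)
      then have "a' j x * b j y0 + (\<Sum>m\<in>T. a' m x * b m y0) = 0"
        using F'_S[OF x y0] split[of "\<lambda>m. a' m x * b m y0"] by simp
      then have e: "(\<Sum>m\<in>T. a' m x * b m y0) = - (a' j x * b j y0)" by simp
      have "(\<Sum>m\<in>T. a' m x * b' m y)
          = (\<Sum>m\<in>T. a' m x * b m y) - b j y / b j y0 * (\<Sum>m\<in>T. a' m x * b m y0)"
        unfolding b'_def sum_distrib_left sum_subtractf[symmetric]
        by (rule sum.cong) (auto simp: algebra_simps)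
      also have "\<dots> = (\<Sum>m\<in>T. a' m x * b m y) + a' j x * b j y"
        unfolding e using bj by simp
      also have "\<dots> = F' x y"
        using F'_S[OF x y] split[of "\<lambda>m. a' m x * b m y"] by simp
      finally show ?thesis by simp
    qed
    obtain A B where AB: "\<forall>x\<in>X. \<forall>y\<in>Y. F' x y = (\<Sum>m\<in>T. A m x * B m y)"
      and A: "\<forall>m\<in>T. A m \<in> lin_span ((\<lambda>y x. F' x y) ` Y)"
      and B: "\<forall>m\<in>T. B m \<in> lin_span (F' ` X)"
      using psubset.IH[OF T, of F' a' b'] F'_T by blast
    have col: "(\<lambda>x. F x y) \<in> lin_span ((\<lambda>y x. F x y) ` Y)" if "y \<in> Y" for y
      using that by (intro lin_span.base) auto
    have row: "F x \<in> lin_span (F ` X)" if "x \<in> X" for x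
      using that by (intro lin_span.base) auto
    have "(\<lambda>y x. F' x y) ` Y \<subseteq> lin_span ((\<lambda>y x. F x y) ` Y)"
    proof safe
      fix y assume "y \<in> Y"
      from lin_span.comb[OF col[OF this] col[OF y0], of "- (F x0 y / q)"]
      show "(\<lambda>x. F' x y) \<in> lin_span ((\<lambda>y x. F x y) ` Y)"
        by (simp add: F'_def mult.commute)
    qed
    then have A': "\<forall>m\<in>T. A m \<in> lin_span ((\<lambda>y x. F x y) ` Y)"
      using A lin_span_minimal by blast
    have "F' ` X \<subseteq> lin_span (F ` X)"
    proof safe
      fix x assume "x \<in> X"
      from lin_span.comb[OF row[OF this] row[OF x0], of "- (F x y0 / q)"]
      show "F' x \<in> lin_span (F ` X)"
        by (simp add: F'_def)
    qed
    then have B': "\<forall>m\<in>T. B m \<in> lin_span (F ` X)"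
      using B lin_span_minimal by blast
    have Bj: "(\<lambda>y. F x0 y / q) \<in> lin_span (F ` X)"
      using lin_span.comb[OF lin_span.zero row[OF x0], of "1 / q"] by simp
    let ?A = "A(j := \<lambda>x. F x y0)" and ?B = "B(j := \<lambda>y. F x0 y / q)"
    have "F x y = (\<Sum>m\<in>S. ?A m x * ?B m y)" if "x \<in> X" "y \<in> Y" for x y
    proof -
      have "(\<Sum>m\<in>T. ?A m x * ?B m y) = (\<Sum>m\<in>T. A m x * B m y)"
        by (rule sum.cong) (auto simp: T_def)
      moreover have "F x y - F x y0 * F x0 y / q = (\<Sum>m\<in>T. A m x * B m y)"
        using AB that by (simp add: F'_def)
      ultimately show ?thesis by (simp add: split)
    qed
    moreover have "\<forall>m\<in>S. ?A m \<in> lin_span ((\<lambda>y x. F x y) ` Y)"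
      using A' col[OF y0] by (auto simp: T_def)
    moreover have "\<forall>m\<in>S. ?B m \<in> lin_span (F ` X)"
      using B' Bj by (auto simp: T_def)
    ultimately show ?thesis by blast
  qed
qed

section \<open>From separable cuts to a tensor train\<close>

text \<open>
  The point \<open>override_on y x {1..l}\<close> has its first \<open>l\<close> coordinates from \<open>x\<close> and the others from
  \<open>y\<close>. Letting \<open>a m\<close> and \<open>b m\<close> be functions of full points, with the two sides decoupled only
  through this gluing, avoids separate types for left and right halves. The definition bounds the rank
  of the unfolding of \<open>h\<close> at the cut \<open>l\<close> by \<open>n\<close>.
\<close>

definition cut_separable :: "nat \<Rightarrow> nat \<Rightarrow> nat \<Rightarrow> ((nat \<Rightarrow> real) \<Rightarrow> real) \<Rightarrow> bool" where
  "cut_separable d l n h \<longleftrightarrow>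
     (\<exists>a b. \<forall>x\<in>cube d. \<forall>y\<in>cube d. h (override_on y x {1..l}) = (\<Sum>m\<in>{1..n}. a m x * b m y))"

lemma override_on_cube: "x \<in> cube d \<Longrightarrow> y \<in> cube d \<Longrightarrow> override_on y x A \<in> cube d"
  by (auto simp: cube_def override_on_def PiE_iff extensional_def)

lemma fun_upd_cube: "x \<in> cube d \<Longrightarrow> l \<in> {1..d} \<Longrightarrow> t \<in> {0..<1} \<Longrightarrow> x(l := t) \<in> cube d"
  by (auto simp: cube_def PiE_iff extensional_def)

lemma cube_nonempty: "(\<lambda>i\<in>{1..d}. 0) \<in> cube d"
  by (auto simp: cube_def)

lemma cubeD: "x \<in> cube d \<Longrightarrow> l \<in> {1..d} \<Longrightarrow> x l \<in> {0..<1}"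
  unfolding cube_def by (rule PiE_mem)

text \<open>
  Moving the cut one step to the right: the coordinate \<open>l + 1\<close> changes sides if it is copied
  from \<open>y\<close> to \<open>x\<close>.
\<close>

lemma override_on_Suc:
  "override_on y x {1..l} = override_on y (x(Suc l := y (Suc l))) {1..Suc l}"
  by (auto simp: override_on_def fun_eq_iff)

text \<open>
  With all other variables frozen, the factors of the product functions in these variables are
  constants; the coefficient of the \<open>i\<close>-th dictionary function collects the multi-indices with
  \<open>I l = i\<close>.
\<close>

lemma ansatz_space_section:
  assumes "in_ansatz_space d p \<Psi> h" and x: "x \<in> cube d" and l: "l \<in> {1..d}"
  shows "\<exists>c. \<forall>t\<in>{0..<1}. h (x(l := t)) = (\<Sum>i\<in>{1..p}. c i * \<Psi> i t)"
proof -
  obtain \<Theta> where \<Theta>: "has_coefficients d p \<Psi> h \<Theta>"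
    using assms(1) by (auto simp: in_ansatz_space_def)
  define w where "w = (\<lambda>I. \<Theta> I * (\<Prod>j\<in>{1..d} - {l}. \<Psi> (I j) (x j)))"
  define c where "c = (\<lambda>i. \<Sum>I\<in>multi_indices d p. if I l = i then w I else 0)"
  have "h (x(l := t)) = (\<Sum>i\<in>{1..p}. c i * \<Psi> i t)" if t: "t \<in> {0..<1}" for t
  proof -
    have pf: "product_function d \<Psi> I (x(l := t))
        = \<Psi> (I l) t * (\<Prod>j\<in>{1..d} - {l}. \<Psi> (I j) (x j))" for I
      unfolding product_function_def
      by (subst prod.remove[of _ l]) (use l in \<open>auto intro!: prod.cong\<close>)
    have "h (x(l := t)) = (\<Sum>I\<in>multi_indices d p. w I * \<Psi> (I l) t)"
      using \<Theta> fun_upd_cube[OF x l t]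
      by (auto simp: has_coefficients_def pf w_def mult_ac intro!: sum.cong)
    also have "\<dots> = (\<Sum>I\<in>multi_indices d p. \<Sum>i\<in>{1..p}. (if I l = i then w I else 0) * \<Psi> i t)"
    proof (rule sum.cong)
      fix I assume "I \<in> multi_indices d p"
      then have "I l \<in> {1..p}" using l unfolding multi_indices_def by (rule PiE_mem)
      then show "w I * \<Psi> (I l) t = (\<Sum>i\<in>{1..p}. (if I l = i then w I else 0) * \<Psi> i t)"
        by (simp add: if_distrib[of "\<lambda>u. u * _"] cong: if_cong)
    qed simp
    also have "\<dots> = (\<Sum>i\<in>{1..p}. c i * \<Psi> i t)"
      unfolding c_def sum_distrib_right by (rule sum.swap)
    finally show ?thesis .
  qed
  then show ?thesis by blast
qed

lemma column_span_section:
  assumes h: "in_ansatz_space d p \<Psi> h" and x: "x \<in> cube d" and l: "l \<in> {1..d}"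
    and u: "u \<in> lin_span ((\<lambda>y x. h (override_on y x {1..l})) ` cube d)"
  shows "\<exists>c. \<forall>t\<in>{0..<1}. u (x(l := t)) = (\<Sum>i\<in>{1..p}. c i * \<Psi> i t)"
  using u
proof (induction rule: lin_span.induct)
  case (base u)
  then obtain y where y: "y \<in> cube d" and u: "u = (\<lambda>x. h (override_on y x {1..l}))" by auto
  have "override_on y (x(l := t)) {1..l} = (override_on y x {1..l})(l := t)" for t
    using l by (auto simp: override_on_def fun_eq_iff)
  show ?case
    unfolding u using ansatz_space_section[OF h override_on_cube[OF x y, of "{1..l}"] l] by (simp only: \<open>\<And>t. override_on y (x(l := t)) {1..l} = (override_on y x {1..l})(l := t)\<close>)
next
  case zero
  show ?case by (intro exI[of _ "\<lambda>_. 0"]) simp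
next
  case (comb u v k)
  then obtain cu cv where "\<forall>t\<in>{0..<1}. u (x(l := t)) = (\<Sum>i\<in>{1..p}. cu i * \<Psi> i t)"
    and "\<forall>t\<in>{0..<1}. v (x(l := t)) = (\<Sum>i\<in>{1..p}. cv i * \<Psi> i t)" by blast
  then show ?case
    by (intro exI[of _ "\<lambda>i. cu i + k * cv i"])
       (simp add: sum_distrib_left sum.distrib algebra_simps del: fun_upd_apply)
qed

text \<open>
  The source of the cores. For a row, obtained by fixing the left variables \<open>x\<close>, the first free
  variable \<open>y (Suc l)\<close> can be counted as a left variable of the next cut; the factorisation at that
  cut then expands the row in the \<open>B m\<close>, with coefficients \<open>A m (x(Suc l := y (Suc l)))\<close>. These are
  in the span of the dictionary because \<open>A m\<close> is in the column span. The property is linear,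
  hence passes from rows to their span.
\<close>

lemma row_span_transfer:
  assumes h: "in_ansatz_space d p \<Psi> h" and l: "l < d"
    and fac: "\<And>x y. x \<in> cube d \<Longrightarrow> y \<in> cube d \<Longrightarrow>
          h (override_on y x {1..Suc l}) = (\<Sum>m\<in>M. A m x * B m y)"
    and A: "\<And>m. m \<in> M \<Longrightarrow> A m \<in> lin_span ((\<lambda>y x. h (override_on y x {1..Suc l})) ` cube d)"
    and u: "u \<in> lin_span ((\<lambda>x y. h (override_on y x {1..l})) ` cube d)"
  shows "\<exists>c. \<forall>y\<in>cube d. u y = (\<Sum>m\<in>M. (\<Sum>i\<in>{1..p}. c i m * \<Psi> i (y (Suc l))) * B m y)"
  using u
proof (induction rule: lin_span.induct)
  case (base u)
  then obtain x where x: "x \<in> cube d" and u: "u = (\<lambda>y. h (override_on y x {1..l}))" by auto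
  have sl: "Suc l \<in> {1..d}" using l by simp
  have "\<forall>m\<in>M. \<exists>c. \<forall>t\<in>{0..<1}. A m (x(Suc l := t)) = (\<Sum>i\<in>{1..p}. c i * \<Psi> i t)"
    using column_span_section[OF h x sl A] by blast
  then obtain c where
    c: "\<forall>m\<in>M. \<forall>t\<in>{0..<1}. A m (x(Suc l := t)) = (\<Sum>i\<in>{1..p}. c m i * \<Psi> i t)"
    by (metis bchoice)
  have "u y = (\<Sum>m\<in>M. (\<Sum>i\<in>{1..p}. c m i * \<Psi> i (y (Suc l))) * B m y)" if y: "y \<in> cube d" for y
  proof -
    have t: "y (Suc l) \<in> {0..<1}" by (rule cubeD[OF y sl])
    have "u y = h (override_on y (x(Suc l := y (Suc l))) {1..Suc l})"
      unfolding u by (subst override_on_Suc) (rule refl)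
    also have "\<dots> = (\<Sum>m\<in>M. A m (x(Suc l := y (Suc l))) * B m y)"
      by (rule fac[OF fun_upd_cube[OF x sl t] y])
    also have "\<dots> = (\<Sum>m\<in>M. (\<Sum>i\<in>{1..p}. c m i * \<Psi> i (y (Suc l))) * B m y)"
      using c t by (intro sum.cong) simp_all
    finally show ?thesis .
  qed
  then show ?case by (intro exI[of _ "\<lambda>i m. c m i"]) simp
next
  case zero
  show ?case by (intro exI[of _ "\<lambda>_ _. 0"]) simp
next
  case (comb u v k)
  let ?s = "\<lambda>c y. \<Sum>m\<in>M. (\<Sum>i\<in>{1..p}. c i m * \<Psi> i (y (Suc l))) * B m y"
  from comb obtain cu cv where cu: "\<forall>y\<in>cube d. u y = ?s cu y" and cv: "\<forall>y\<in>cube d. v y = ?s cv y"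
    by blast
  have "?s cu y + k * ?s cv y = ?s (\<lambda>i m. cu i m + k * cv i m) y" for y
    by (simp add: distrib_right sum.distrib sum_distrib_left sum_distrib_right mult.assoc)
  with cu cv show ?case
    by (intro exI[of _ "\<lambda>i m. cu i m + k * cv i m"]) simp
qed

text \<open>
  A product of the matrices \<open>K 1, \<dots>, K l\<close> applied to the vector \<open>b l\<close>, written as a sum over all index
  paths; this is the shape of a tensor train contraction.
\<close>

lemma transfer_chain:
  fixes b :: "nat \<Rightarrow> nat \<Rightarrow> real"
  assumes step: "\<And>l m. l < d \<Longrightarrow> m \<in> S l \<Longrightarrow>
      b l m = (\<Sum>m'\<in>S (Suc l). K (Suc l) m m' * b (Suc l) m')"
    and "l \<le> d"
  shows "(\<Sum>m\<in>S 0. b 0 m)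
    = (\<Sum>J\<in>PiE {0..l} S. (\<Prod>i\<in>{1..l}. K i (J (i - 1)) (J i)) * b l (J l))"
  using assms(2)
proof (induction l)
  case 0
  have "PiE {0..0::nat} S = (\<lambda>(m, J). J(0 := m)) ` (S 0 \<times> {\<lambda>_. undefined})"
    using PiE_insert_eq[of 0 "{}" S] by simp
  then have *: "PiE {0..0::nat} S = (\<lambda>m. (\<lambda>_. undefined)(0 := m)) ` S 0" by auto
  have inj: "inj_on (\<lambda>m. (\<lambda>_. undefined)(0 := m)) (S 0)"
    by (auto simp: inj_on_def dest: fun_cong[of _ _ 0])
  show ?case unfolding * sum.reindex[OF inj] by simp
next
  case (Suc l)
  have eq: "{0..Suc l} = insert (Suc l) {0..l}" by auto
  have inj: "inj_on (\<lambda>(m, J). J(Suc l := m)) (S (Suc l) \<times> PiE {0..l} S)"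
    by (rule inj_combinator) simp
  define w where "w = (\<lambda>l J. \<Prod>i\<in>{1..l}. K i (J (i - 1)) (J i))"
  have upd: "w (Suc l) (J(Suc l := m)) = w l J * K (Suc l) (J l) m" for J m
  proof -
    have "w l (J(Suc l := m)) = w l J" unfolding w_def by (rule prod.cong) auto
    then show ?thesis by (simp add: w_def prod.nat_ivl_Suc' mult.commute)
  qed
  have "(\<Sum>m\<in>S 0. b 0 m) = (\<Sum>J\<in>PiE {0..l} S. w l J * b l (J l))"
    using Suc by (simp add: w_def)
  also have "\<dots> = (\<Sum>J\<in>PiE {0..l} S. \<Sum>m\<in>S (Suc l).
      w l J * K (Suc l) (J l) m * b (Suc l) m)"
  proof (rule sum.cong)
    fix J assume "J \<in> PiE {0..l} S"
    then have "J l \<in> S l" by (rule PiE_mem) simp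
    then show "w l J * b l (J l) = (\<Sum>m\<in>S (Suc l). w l J * K (Suc l) (J l) m * b (Suc l) m)"
      using step[of l "J l"] Suc.prems by (simp add: sum_distrib_left mult.assoc)
  qed simp
  also have "\<dots> = (\<Sum>(m, J)\<in>S (Suc l) \<times> PiE {0..l} S.
      w l J * K (Suc l) (J l) m * b (Suc l) m)"
    by (subst sum.swap) (simp add: sum.cartesian_product)
  also have "\<dots> = (\<Sum>J\<in>PiE {0..Suc l} S. w (Suc l) J * b (Suc l) (J (Suc l)))"
    unfolding eq PiE_insert_eq sum.reindex[OF inj]
    by (rule sum.cong) (auto simp: upd)
  finally show ?case unfolding w_def .
qed

text \<open>
  The skeleton decompositions of all cuts are linked by \<open>row_span_transfer\<close> to
  \<open>h y = \<Sum>\<^sub>J \<Prod>\<^sub>l K\<^sub>l(y\<^sub>l)\<close>, where the entry of \<open>K\<^sub>l(y\<^sub>l)\<close> at \<open>(J (l - 1), J l)\<close> is a combination of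
  \<open>\<Psi>\<^sub>i(y\<^sub>l)\<close>. Expanding the product exhibits the coefficients as a contraction of the coefficients of
  these combinations.
\<close>

theorem separable_cuts_imp_admits_TT:
  assumes d: "1 \<le> d" and h: "in_ansatz_space d p \<Psi> h"
    and sep: "\<And>l. l \<in> {1..<d} \<Longrightarrow> cut_separable d l (r l) h"
  shows "admits_TT d p \<Psi> h r"
proof -
  define n where "n = (\<lambda>l. if l \<in> {1..<d} then r l else 1)"
  define z :: "nat \<Rightarrow> real" where "z = (\<lambda>i\<in>{1..d}. 0)"
  have z: "z \<in> cube d" unfolding z_def by (rule cube_nonempty)
  let ?row = "\<lambda>l x y. h (override_on y x {1..l})"
  let ?col = "\<lambda>l y x. h (override_on y x {1..l})"
  have "\<forall>l\<in>{0..d}. \<exists>AB. (\<forall>x\<in>cube d. \<forall>y\<in>cube d.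
        h (override_on y x {1..l}) = (\<Sum>m\<in>{1..n l}. fst AB m x * snd AB m y))
      \<and> (1 \<le> l \<longrightarrow> (\<forall>m\<in>{1..n l}. fst AB m \<in> lin_span (?col l ` cube d)))
      \<and> (l < d \<longrightarrow> (\<forall>m\<in>{1..n l}. snd AB m \<in> lin_span (?row l ` cube d)))
      \<and> (l = 0 \<longrightarrow> snd AB 1 = h) \<and> (l = d \<longrightarrow> snd AB 1 = (\<lambda>_. 1))"
    (is "\<forall>l\<in>_. \<exists>AB. ?P l AB")
  proof
    fix l assume l: "l \<in> {0..d}"
    consider "l = 0" | "l = d" "l \<noteq> 0" | "l \<in> {1..<d}" using l by fastforce
    then show "\<exists>AB. ?P l AB"
    proof cases
      case 1
      \<comment> \<open>Left of the cut there is no variable, and \<open>h\<close> itself is the only row.\<close>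
      have "h \<in> lin_span (?row 0 ` cube d)"
        by (rule lin_span.base, rule image_eqI[OF _ z]) simp
      with 1 d show ?thesis
        by (intro exI[of _ "(\<lambda>_ _. 1, \<lambda>_. h)"]) (auto simp: n_def)
    next
      case 2
      \<comment> \<open>Right of the cut there is no variable, and \<open>h\<close> itself is the only column.\<close>
      have "override_on y x {1..d} = override_on z x {1..d}" if "x \<in> cube d" "y \<in> cube d" for x y
        using that z by (auto simp: cube_def override_on_def fun_eq_iff PiE_iff extensional_def)
      then have e: "h (override_on y x {1..d}) = h (override_on z x {1..d})"
        if "x \<in> cube d" "y \<in> cube d" for x y using that by metis
      have "?col d z \<in> lin_span (?col d ` cube d)"
        by (rule lin_span.base, rule image_eqI[OF _ z]) simp
      with 2 d e show ?thesis
        by (intro exI[of _ "(\<lambda>_. ?col d z, \<lambda>_ _. 1)"]) (auto simp: n_def)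
    next
      case 3
      then obtain a b where
        ab: "\<And>x y. x \<in> cube d \<Longrightarrow> y \<in> cube d \<Longrightarrow>
          ?row l x y = (\<Sum>m\<in>{1..r l}. a m x * b m y)"
        using sep[OF 3] unfolding cut_separable_def by blast
      obtain A B where
        "(\<forall>x\<in>cube d. \<forall>y\<in>cube d. ?row l x y = (\<Sum>m\<in>{1..r l}. A m x * B m y)) \<and>
         (\<forall>m\<in>{1..r l}. A m \<in> lin_span (?col l ` cube d)) \<and>
         (\<forall>m\<in>{1..r l}. B m \<in> lin_span (?row l ` cube d))"
        by (rule skeleton_decomposition[OF finite_atLeastAtMost ab, THEN exE])
           (assumption, assumption, erule exE, rule that)
      with 3 show ?thesis
        by (intro exI[of _ "(A, B)"]) (simp add: n_def)
    qed
  qed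
  then obtain AB where AB: "\<forall>l\<in>{0..d}. ?P l (AB l)" by (rule bchoice[THEN exE])
  define A where "A = (\<lambda>l. fst (AB l))"
  define B where "B = (\<lambda>l. snd (AB l))"
  have fac: "h (override_on y x {1..l}) = (\<Sum>m\<in>{1..n l}. A l m x * B l m y)"
    if "l \<le> d" "x \<in> cube d" "y \<in> cube d" for l x y
    using AB that by (simp add: A_def B_def)
  have A: "A l m \<in> lin_span (?col l ` cube d)" if "l \<in> {1..d}" "m \<in> {1..n l}" for l m
    using AB that by (simp add: A_def)
  have B: "B l m \<in> lin_span (?row l ` cube d)" if "l < d" "m \<in> {1..n l}" for l m
    using AB that by (simp add: B_def)
  have B0: "B 0 1 = h" and Bd: "B d 1 = (\<lambda>_. 1)"
    using bspec[OF AB, of 0] bspec[OF AB, of d] by (simp_all add: B_def)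
  have "\<forall>q\<in>{(l, m). l < d \<and> m \<in> {1..n l}}. \<exists>c. \<forall>y\<in>cube d. B (fst q) (snd q) y =
      (\<Sum>m'\<in>{1..n (Suc (fst q))}. (\<Sum>i\<in>{1..p}. c i m' * \<Psi> i (y (Suc (fst q)))) * B (Suc (fst q)) m' y)"
  proof safe
    fix l m assume l: "l < d" and m: "m \<in> {1..n l}"
    show "\<exists>c. \<forall>y\<in>cube d. B (fst (l, m)) (snd (l, m)) y =
      (\<Sum>m'\<in>{1..n (Suc (fst (l, m)))}. (\<Sum>i\<in>{1..p}. c i m' * \<Psi> i (y (Suc (fst (l, m)))))
        * B (Suc (fst (l, m))) m' y)"
      unfolding fst_conv snd_conv
      by (rule row_span_transfer[OF h l fac A B[OF l m]]) (use l in auto)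
  qed
  then obtain c where "\<forall>q\<in>{(l, m). l < d \<and> m \<in> {1..n l}}. \<forall>y\<in>cube d. B (fst q) (snd q) y =
      (\<Sum>m'\<in>{1..n (Suc (fst q))}. (\<Sum>i\<in>{1..p}. c q i m' * \<Psi> i (y (Suc (fst q)))) * B (Suc (fst q)) m' y)"
    by (rule bchoice[THEN exE])
  then have c: "B l m y =
      (\<Sum>m'\<in>{1..n (Suc l)}. (\<Sum>i\<in>{1..p}. c (l, m) i m' * \<Psi> i (y (Suc l))) * B (Suc l) m' y)"
    if "l < d" "m \<in> {1..n l}" "y \<in> cube d" for l m y
    using that by fastforce
  define C where "C = (\<lambda>l i m m'. c (l - 1, m) i m')"
  have bonds: "bond_indices d r = PiE {0..d} (\<lambda>l. {1..n l})"
    unfolding bond_indices_def n_def by (rule PiE_cong) auto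
  have "h y = (\<Sum>I\<in>multi_indices d p. tt_contraction d r C I * product_function d \<Psi> I y)"
    if y: "y \<in> cube d" for y
  proof -
    have "h y = (\<Sum>m\<in>{1..n 0}. B 0 m y)"
      by (simp add: n_def B0[simplified])
    also have "\<dots> = (\<Sum>J\<in>bond_indices d r.
        (\<Prod>l\<in>{1..d}. \<Sum>i\<in>{1..p}. C l i (J (l - 1)) (J l) * \<Psi> i (y l)) * B d (J d) y)"
      unfolding bonds
      by (rule transfer_chain[where d = d and b = "\<lambda>l m. B l m y"
            and K = "\<lambda>l m m'. \<Sum>i\<in>{1..p}. C l i m m' * \<Psi> i (y l)"])
         (use c y in \<open>auto simp: C_def\<close>)
    also have "\<dots> = (\<Sum>J\<in>bond_indices d r.
        \<Prod>l\<in>{1..d}. \<Sum>i\<in>{1..p}. C l i (J (l - 1)) (J l) * \<Psi> i (y l))"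
    proof (rule sum.cong)
      fix J assume "J \<in> bond_indices d r"
      then have "J d \<in> {1..n d}" unfolding bonds by (rule PiE_mem) simp
      then have "J d = 1" by (simp add: n_def)
      then show "(\<Prod>l\<in>{1..d}. \<Sum>i\<in>{1..p}. C l i (J (l - 1)) (J l) * \<Psi> i (y l)) * B d (J d) y
        = (\<Prod>l\<in>{1..d}. \<Sum>i\<in>{1..p}. C l i (J (l - 1)) (J l) * \<Psi> i (y l))"
        using Bd by simp
    qed simp
    also have "\<dots> = (\<Sum>J\<in>bond_indices d r. \<Sum>I\<in>multi_indices d p.
        (\<Prod>l\<in>{1..d}. C l (I l) (J (l - 1)) (J l)) * product_function d \<Psi> I y)"
      unfolding multi_indices_def product_function_def prod.distrib[symmetric]
      by (intro sum.cong refl prod_sum_PiE) auto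
    also have "\<dots> = (\<Sum>I\<in>multi_indices d p. tt_contraction d r C I * product_function d \<Psi> I y)"
      unfolding tt_contraction_def sum_distrib_right by (rule sum.swap)
    finally show ?thesis .
  qed
  then show ?thesis
    unfolding admits_TT_def has_coefficients_def by blast
qed

section \<open>Separability of the truncated law\<close>

lemma cut_separable_mono:
  assumes "cut_separable d l n h" and "n \<le> n'"
  shows "cut_separable d l n' h"
proof -
  obtain a b where ab: "\<forall>x\<in>cube d. \<forall>y\<in>cube d.
      h (override_on y x {1..l}) = (\<Sum>m\<in>{1..n}. a m x * b m y)"
    using assms(1) unfolding cut_separable_def by blast
  have "(\<Sum>m\<in>{1..n}. a m x * b m y) = (\<Sum>m\<in>{1..n'}. (if m \<le> n then a m x else 0) * b m y)"
    for x y :: "nat \<Rightarrow> real"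
    using assms(2) by (intro sum.mono_neutral_cong_left) auto
  with ab show ?thesis
    unfolding cut_separable_def by (intro exI[of _ "\<lambda>m x. if m \<le> n then a m x else 0"] exI[of _ b]) simp
qed

lemma cut_separable_add:
  assumes "cut_separable d l n h" and "cut_separable d l n' h'"
  shows "cut_separable d l (n + n') (\<lambda>x. h x + h' x)"
proof -
  obtain a b where ab: "\<forall>x\<in>cube d. \<forall>y\<in>cube d.
      h (override_on y x {1..l}) = (\<Sum>m\<in>{1..n}. a m x * b m y)"
    using assms(1) unfolding cut_separable_def by blast
  obtain a' b' where ab': "\<forall>x\<in>cube d. \<forall>y\<in>cube d.
      h' (override_on y x {1..l}) = (\<Sum>m\<in>{1..n'}. a' m x * b' m y)"
    using assms(2) unfolding cut_separable_def by blast
  let ?a = "\<lambda>m. if m \<le> n then a m else a' (m - n)" and ?b = "\<lambda>m. if m \<le> n then b m else b' (m - n)"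
  have "(\<Sum>m\<in>{1..n + n'}. ?a m x * ?b m y)
      = (\<Sum>m\<in>{1..n}. a m x * b m y) + (\<Sum>m\<in>{1..n'}. a' m x * b' m y)" for x y
  proof -
    have "(\<Sum>m\<in>{1..n + n'}. ?a m x * ?b m y)
        = (\<Sum>m\<in>{1..n}. ?a m x * ?b m y) + (\<Sum>m\<in>{n + 1..n + n'}. ?a m x * ?b m y)"
      by (rule sum.ub_add_nat) simp
    moreover have "(\<Sum>m\<in>{n + 1..n + n'}. ?a m x * ?b m y) = (\<Sum>m\<in>{1..n'}. a' m x * b' m y)"
      by (rule sum.reindex_bij_witness[of _ "\<lambda>m. m + n" "\<lambda>m. m - n"]) auto
    ultimately show ?thesis by simp
  qed
  with ab ab' show ?thesis
    unfolding cut_separable_def by (intro exI[of _ ?a] exI[of _ ?b]) simp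
qed

lemma cut_separable_scale:
  assumes "cut_separable d l n h"
  shows "cut_separable d l n (\<lambda>x. k * h x)"
proof -
  obtain a b where "\<forall>x\<in>cube d. \<forall>y\<in>cube d.
      h (override_on y x {1..l}) = (\<Sum>m\<in>{1..n}. a m x * b m y)"
    using assms unfolding cut_separable_def by blast
  then show ?thesis
    unfolding cut_separable_def
    by (intro exI[of _ "\<lambda>m x. k * a m x"] exI[of _ b]) (simp add: sum_distrib_left mult.assoc)
qed

lemma cut_separable_sum:
  assumes "finite S" and "\<And>L. L \<in> S \<Longrightarrow> cut_separable d l n (h L)"
  shows "cut_separable d l (n * card S) (\<lambda>x. \<Sum>L\<in>S. h L x)"
  using assms
proof (induction S)
  case empty
  show ?case by (simp add: cut_separable_def)
next
  case (insert L S)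
  then have "cut_separable d l (n + n * card S) (\<lambda>x. h L x + (\<Sum>L\<in>S. h L x))"
    by (intro cut_separable_add) auto
  with insert show ?case by simp
qed

text \<open>The infimum in \<open>separation_rank\<close> is attained, since \<open>enat\<close> is well ordered.\<close>

lemma separation_rank_le_imp_separated_sum:
  assumes "separation_rank d U V h \<le> enat N"
  obtains s where "s \<le> N" and "separated_sum d U V h s"
proof -
  let ?S = "{s. separated_sum d U V h s}"
  have "enat ` ?S \<noteq> {}"
  proof
    assume empty: "enat ` ?S = {}"
    have "separation_rank d U V h = \<infinity>"
      unfolding separation_rank_def empty by (simp add: top_enat_def)
    with assms show False by simp
  qed
  then have "Inf (enat ` ?S) \<in> enat ` ?S" by (meson ex_in_conv wellorder_InfI)
  then show thesis using assms that unfolding separation_rank_def by auto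
qed

lemma separated_sum_imp_cut_separable:
  assumes "separated_sum d U V h s" and "U \<subseteq> {1..l}" and "V \<inter> {1..l} = {}"
  shows "cut_separable d l s h"
proof -
  obtain gl gr where g: "\<forall>x\<in>cube d. h x = (\<Sum>m\<in>{1..s}. gl m (restrict x U) * gr m (restrict x V))"
    using assms(1) unfolding separated_sum_def by blast
  have "restrict (override_on y x {1..l}) U = restrict x U" for x y :: "nat \<Rightarrow> real"
    using assms(2) by (auto simp: override_on_def fun_eq_iff restrict_def)
  moreover have "restrict (override_on y x {1..l}) V = restrict y V" for x y :: "nat \<Rightarrow> real"
    using assms(3) by (auto simp: override_on_def fun_eq_iff restrict_def)
  ultimately show ?thesis
    unfolding cut_separable_def using g
    by (intro exI[of _ "\<lambda>m x. gl m (restrict x U)"] exI[of _ "\<lambda>m y. gr m (restrict y V)"])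
       (simp add: override_on_cube)
qed

lemma depends_on_one_side_imp_cut_separable:
  assumes h: "depends_only_on d W h" and W: "W \<subseteq> {1..l} \<or> W \<inter> {1..l} = {}"
  shows "cut_separable d l 1 h"
  using W
proof
  assume W: "W \<subseteq> {1..l}"
  have "h (override_on y x {1..l}) = h x" if "x \<in> cube d" "y \<in> cube d" for x y
    using h override_on_cube[OF that] that(1) W unfolding depends_only_on_def
    by (metis override_on_apply_in subsetD)
  then show ?thesis
    unfolding cut_separable_def by (intro exI[of _ "\<lambda>_. h"] exI[of _ "\<lambda>_ _. 1"]) simp
next
  assume W: "W \<inter> {1..l} = {}"
  have "h (override_on y x {1..l}) = h y" if "x \<in> cube d" "y \<in> cube d" for x y
    using h override_on_cube[OF that] that(2) W unfolding depends_only_on_def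
    by (metis override_on_apply_notin disjoint_iff)
  then show ?thesis
    unfolding cut_separable_def by (intro exI[of _ "\<lambda>_ _. 1"] exI[of _ "\<lambda>_. h"]) simp
qed

text \<open>
  A cut outside the window leaves all relevant variables on one side, so one summand is enough.
  That is within the budget \<open>N\<close> unless \<open>N = 0\<close>; but then the rank condition at the cut \<open>k\<close>, which
  is always in the window, forces \<open>h\<close> to vanish.
\<close>

lemma interaction_cut_separable:
  assumes dep: "depends_only_on d ({k - L..k + L} \<inter> {1..d}) h"
    and rank: "\<And>l. l \<in> {k - L..k + L} \<Longrightarrow>
      separation_rank d ({k - L..l} \<inter> {1..d}) ({l + 1..k + L} \<inter> {1..d}) h \<le> enat N"
  shows "cut_separable d l N h"
proof (cases "l \<in> {k - L..k + L}")
  case True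
  from separation_rank_le_imp_separated_sum[OF rank[OF True]]
  obtain s where s: "s \<le> N"
    and "separated_sum d ({k - L..l} \<inter> {1..d}) ({l + 1..k + L} \<inter> {1..d}) h s" .
  then have "cut_separable d l s h"
    by (rule_tac separated_sum_imp_cut_separable) auto
  then show ?thesis using s by (rule cut_separable_mono)
next
  case False
  have one: "cut_separable d l 1 h"
    by (rule depends_on_one_side_imp_cut_separable[OF dep]) (use False in auto)
  show ?thesis
  proof (cases "N = 0")
    case True
    obtain s where "s \<le> N"
      and s: "separated_sum d ({k - L..k} \<inter> {1..d}) ({k + 1..k + L} \<inter> {1..d}) h s"
      using separation_rank_le_imp_separated_sum[OF rank[of k]] by auto
    then have "\<forall>x\<in>cube d. h x = 0" using True by (auto simp: separated_sum_def)
    then show ?thesis by (auto simp: cut_separable_def True override_on_cube)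
  next
    case False
    then show ?thesis using one by (intro cut_separable_mono[OF one]) simp
  qed
qed

lemma in_ansatz_space_sum:
  assumes "\<And>L. L \<in> S \<Longrightarrow> in_ansatz_space d p \<Psi> (h L)"
  shows "in_ansatz_space d p \<Psi> (\<lambda>x. \<Sum>L\<in>S. w L * h L x)"
proof -
  obtain \<Theta> where \<Theta>: "\<forall>L\<in>S. has_coefficients d p \<Psi> (h L) (\<Theta> L)"
    using assms unfolding in_ansatz_space_def by metis
  have "has_coefficients d p \<Psi> (\<lambda>x. \<Sum>L\<in>S. w L * h L x) (\<lambda>I. \<Sum>L\<in>S. w L * \<Theta> L I)"
    unfolding has_coefficients_def
  proof
    fix x assume x: "x \<in> cube d"
    have "(\<Sum>L\<in>S. w L * h L x)
        = (\<Sum>L\<in>S. \<Sum>I\<in>multi_indices d p. w L * \<Theta> L I * product_function d \<Psi> I x)"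
      using \<Theta> x by (auto simp: has_coefficients_def sum_distrib_left mult.assoc intro!: sum.cong)
    also have "\<dots> = (\<Sum>I\<in>multi_indices d p. (\<Sum>L\<in>S. w L * \<Theta> L I) * product_function d \<Psi> I x)"
      by (subst sum.swap) (simp add: sum_distrib_right)
    finally show "(\<Sum>L\<in>S. w L * h L x)
      = (\<Sum>I\<in>multi_indices d p. (\<Sum>L\<in>S. w L * \<Theta> L I) * product_function d \<Psi> I x)" .
  qed
  then show ?thesis unfolding in_ansatz_space_def by blast
qed

section \<open>The truncation error\<close>

lemma space_cube_measure: "space (cube_measure d) = cube d"
  by (simp add: cube_measure_def cube_def space_PiM space_restrict_space)

lemma L2_norm_nonneg: "0 \<le> L2_norm d h"
  by (simp add: L2_norm_def)

text \<open>
  Instead of the triangle inequality in \<open>L\<^sup>2\<close>, the discrete Cauchy-Schwarz inequality is applied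
  at each point to the weights split as \<open>sqrt (w L) * sqrt (w L)\<close>. Integrating
  \<open>(\<Sum>\<^sub>L w L * h L x)\<^sup>2 \<le> (\<Sum>\<^sub>L w L) * (\<Sum>\<^sub>L w L * (h L x)\<^sup>2)\<close> yields the sharp bound when all norms have
  the common bound \<open>g\<close>, and integrability of the square comes with it.
\<close>

lemma L2_norm_weighted_sum:
  assumes "finite S" and w: "\<And>L. L \<in> S \<Longrightarrow> 0 \<le> w L"
    and sq: "\<And>L. L \<in> S \<Longrightarrow> square_integrable d (h L)"
    and g: "\<And>L. L \<in> S \<Longrightarrow> L2_norm d (h L) \<le> g" and g0: "0 \<le> g"
    and e: "\<And>x. x \<in> cube d \<Longrightarrow> e x = (\<Sum>L\<in>S. w L * h L x)"
  shows "square_integrable d e" and "L2_norm d e \<le> (\<Sum>L\<in>S. w L) * g"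
proof -
  let ?M = "cube_measure d" and ?W = "\<Sum>L\<in>S. w L"
  have W: "0 \<le> ?W" using w by (rule sum_nonneg)
  have [measurable]: "h L \<in> borel_measurable ?M" if "L \<in> S" for L
    using sq[OF that] by (simp add: square_integrable_def)
  have int: "integrable ?M (\<lambda>x. (h L x)\<^sup>2)" if "L \<in> S" for L
    using sq[OF that] by (simp add: square_integrable_def)
  have "(\<lambda>x. \<Sum>L\<in>S. w L * h L x) \<in> borel_measurable ?M" by measurable
  then have meas: "e \<in> borel_measurable ?M"
    using e by (subst measurable_cong) (auto simp: space_cube_measure)
  have pointwise: "(e x)\<^sup>2 \<le> ?W * (\<Sum>L\<in>S. w L * (h L x)\<^sup>2)" if "x \<in> cube d" for x
  proof -
    have "(e x)\<^sup>2 = (\<Sum>L\<in>S. sqrt (w L) * (sqrt (w L) * h L x))\<^sup>2"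
      using w by (simp add: e[OF that] mult.assoc[symmetric])
    also have "\<dots> \<le> (\<Sum>L\<in>S. (sqrt (w L))\<^sup>2) * (\<Sum>L\<in>S. (sqrt (w L) * h L x)\<^sup>2)"
      by (rule Cauchy_Schwarz_ineq_sum)
    also have "\<dots> = ?W * (\<Sum>L\<in>S. w L * (h L x)\<^sup>2)"
      using w by (simp add: power_mult_distrib)
    finally show ?thesis .
  qed
  have bound_int: "integrable ?M (\<lambda>x. ?W * (\<Sum>L\<in>S. w L * (h L x)\<^sup>2))"
    using int by (intro integrable_mult_right Bochner_Integration.integrable_sum) auto
  have int_e: "integrable ?M (\<lambda>x. (e x)\<^sup>2)"
    by (rule Bochner_Integration.integrable_bound[OF bound_int])
       (use meas pointwise in \<open>auto simp: space_cube_measure intro!: AE_I2 order_trans[OF _ abs_ge_self]\<close>)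
  show "square_integrable d e"
    using meas int_e by (simp add: square_integrable_def)
  have "(\<integral>x. (e x)\<^sup>2 \<partial>?M) \<le> (\<integral>x. ?W * (\<Sum>L\<in>S. w L * (h L x)\<^sup>2) \<partial>?M)"
    using int_e bound_int pointwise by (intro integral_mono) (auto simp: space_cube_measure)
  also have "\<dots> = ?W * (\<Sum>L\<in>S. w L * (\<integral>x. (h L x)\<^sup>2 \<partial>?M))"
    using int by (simp add: Bochner_Integration.integral_sum)
  also have "\<dots> \<le> ?W * (\<Sum>L\<in>S. w L * g\<^sup>2)"
  proof (intro mult_left_mono sum_mono W w)
    fix L assume "L \<in> S"
    from g[OF this] show "(\<integral>x. (h L x)\<^sup>2 \<partial>?M) \<le> g\<^sup>2"
      unfolding L2_norm_def by (rule sqrt_le_D)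
  qed
  also have "\<dots> = (?W * g)\<^sup>2"
    by (simp add: sum_distrib_right[symmetric] power_mult_distrib) (simp add: power2_eq_square)
  finally show "L2_norm d e \<le> ?W * g"
    unfolding L2_norm_def using W g0 by (intro real_le_lsqrt) auto
qed

text \<open>
  The mean value theorem for \<open>z powr (1 - \<alpha>)\<close> replaces the comparison of \<open>\<Sum> L\<^sup>-\<^sup>\<alpha>\<close> with an
  integral; the right-hand sides telescope.
\<close>

lemma powr_telescope:
  fixes \<alpha> :: real
  assumes \<alpha>: "1 < \<alpha>" and n: "1 \<le> n"
  shows "real (Suc n) powr (- \<alpha>) \<le> (real n powr (1 - \<alpha>) - real (Suc n) powr (1 - \<alpha>)) / (\<alpha> - 1)"
proof -
  have "\<exists>z>real n. z < real (Suc n) \<and> real (Suc n) powr (1 - \<alpha>) - real n powr (1 - \<alpha>)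
      = (real (Suc n) - real n) * ((1 - \<alpha>) * z powr (1 - \<alpha> - 1))"
  proof (rule MVT2)
    fix z assume "real n \<le> z"
    with n show "((\<lambda>z. z powr (1 - \<alpha>)) has_real_derivative (1 - \<alpha>) * z powr (1 - \<alpha> - 1)) (at z)"
      by (intro has_real_derivative_powr) simp
  qed simp
  then obtain z where z: "real n < z" "z < real (Suc n)"
    and e: "real n powr (1 - \<alpha>) - real (Suc n) powr (1 - \<alpha>) = (\<alpha> - 1) * z powr (- \<alpha>)"
    by (auto simp: algebra_simps)
  have "real (Suc n) powr (- \<alpha>) \<le> z powr (- \<alpha>)"
    using z n \<alpha> by (intro powr_mono2') auto
  then show ?thesis unfolding e using \<alpha> by simp
qed

text \<open>
  The first term of the tail is kept apart, as \<open>powr_telescope\<close> would bound it through the index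
  \<open>n - 1\<close>, which fails for \<open>n = 1\<close>. It is at most \<open>n powr (1 - \<alpha>)\<close>, which turns
  the constant \<open>1 / (\<alpha> - 1)\<close> of the telescoping sum into \<open>\<alpha> / (\<alpha> - 1)\<close>.
\<close>

lemma powr_tail_sum:
  fixes \<alpha> :: real
  assumes \<alpha>: "1 < \<alpha>" and n: "1 \<le> n"
  shows "(\<Sum>L\<in>{n..d}. real L powr (- \<alpha>)) \<le> \<alpha> / (\<alpha> - 1) * real n powr (1 - \<alpha>)"
proof (cases "n \<le> d")
  case False
  then show ?thesis using \<alpha> by simp
next
  case True
  then have "(\<Sum>L\<in>{n..d}. real L powr (- \<alpha>))
      \<le> real n powr (- \<alpha>) + (real n powr (1 - \<alpha>) - real d powr (1 - \<alpha>)) / (\<alpha> - 1)"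
  proof (induction d rule: dec_induct)
    case base
    then show ?case by simp
  next
    case (step m)
    have "(\<Sum>L\<in>{n..Suc m}. real L powr (- \<alpha>))
        = (\<Sum>L\<in>{n..m}. real L powr (- \<alpha>)) + real (Suc m) powr (- \<alpha>)"
      using step by simp
    with step.IH powr_telescope[OF \<alpha>, of m] step.hyps n show ?case
      by (simp add: diff_divide_distrib)
  qed
  also have "\<dots> \<le> real n powr (1 - \<alpha>) + real n powr (1 - \<alpha>) / (\<alpha> - 1)"
    using \<alpha> n by (intro add_mono powr_mono divide_right_mono) auto
  also have "\<dots> = \<alpha> / (\<alpha> - 1) * real n powr (1 - \<alpha>)"
    using \<alpha> by (simp add: field_simps)
  finally show ?thesis .
qed

lemma cutoff_error:
  fixes \<alpha> g \<epsilon> :: real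
  assumes \<alpha>: "1 < \<alpha>" and \<epsilon>: "0 < \<epsilon>" and g: "0 \<le> g"
    and n: "(\<alpha> / (\<alpha> - 1) * (g / \<epsilon>)) powr (1 / (\<alpha> - 1)) \<le> real n" and n1: "1 \<le> n"
  shows "(\<Sum>L\<in>{n..d}. real L powr (- \<alpha>)) * g \<le> \<epsilon>"
proof (cases "g = 0")
  case True
  then show ?thesis using \<epsilon> by simp
next
  case False
  define X where "X = \<alpha> / (\<alpha> - 1) * (g / \<epsilon>)"
  have X: "0 < X" using \<alpha> \<epsilon> g False by (simp add: X_def)
  have "real n powr (1 - \<alpha>) \<le> (X powr (1 / (\<alpha> - 1))) powr (1 - \<alpha>)"
    using n X \<alpha> by (intro powr_mono2') (auto simp: X_def)
  also have "\<dots> = X powr (- 1)"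
  proof -
    have "1 / (\<alpha> - 1) * (1 - \<alpha>) = - 1" using \<alpha> by (simp add: field_simps)
    then show ?thesis unfolding powr_powr by simp
  qed
  also have "\<dots> = 1 / X" using X by (simp add: powr_minus_divide)
  finally have b: "real n powr (1 - \<alpha>) \<le> 1 / X" .
  have "(\<Sum>L\<in>{n..d}. real L powr (- \<alpha>)) * g \<le> (\<alpha> / (\<alpha> - 1) * real n powr (1 - \<alpha>)) * g"
    using powr_tail_sum[OF \<alpha> n1] g by (rule mult_right_mono)
  also have "\<dots> \<le> (\<alpha> / (\<alpha> - 1) * (1 / X)) * g"
    using b \<alpha> g by (intro mult_right_mono mult_left_mono) auto
  also have "\<dots> = \<epsilon>"
    using \<alpha> \<epsilon> False g by (simp add: X_def field_simps)
  finally show ?thesis .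
qed

section \<open>Approximation of algebraically decaying laws\<close>

theorem corollary7:
  fixes d N p :: nat and \<alpha> g \<epsilon> :: real
    and f :: "(nat \<Rightarrow> real) \<Rightarrow> nat \<Rightarrow> real"
    and G :: "nat \<Rightarrow> nat \<Rightarrow> (nat \<Rightarrow> real) \<Rightarrow> real"
    and \<Psi> :: "nat \<Rightarrow> real \<Rightarrow> real"
  assumes "algebraically_decaying d \<alpha> g N f G"
    and "dictionary p \<Psi>"
    and "\<And>k L. k \<in> {1..d} \<Longrightarrow> L \<in> {1..d} \<Longrightarrow> in_ansatz_space d p \<Psi> (G k L)"
    and "\<alpha> > 1" and "\<epsilon> > 0"
  shows "\<forall>k\<in>{1..d}. \<exists>h r.
           square_integrable d (\<lambda>x. f x k - h x) \<and>
           L2_norm d (\<lambda>x. f x k - h x) \<le> \<epsilon> \<and>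
           admits_TT d p \<Psi> h r \<and>
           tt_rank d r \<le> N * nat \<lceil>(\<alpha> / (\<alpha> - 1) * (g / \<epsilon>)) powr (1 / (\<alpha> - 1)) - 1\<rceil>"
proof
  fix k assume k: "k \<in> {1..d}"
  \<comment> \<open>The least cutoff with \<open>X \<le> R + 1\<close>, the condition under which the tail from \<open>R + 1\<close> on is
    small enough.\<close>
  define X where "X = (\<alpha> / (\<alpha> - 1) * (g / \<epsilon>)) powr (1 / (\<alpha> - 1))"
  define R where "R = nat \<lceil>X - 1\<rceil>"
  have X: "X \<le> real (R + 1)" unfolding R_def by linarith
  define h where "h = (\<lambda>x. \<Sum>L\<in>{1..d} \<inter> {..R}. real L powr (- \<alpha>) * G k L x)"
  note decay = assms(1)[unfolded algebraically_decaying_def]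
  have f: "f x k = (\<Sum>L\<in>{1..d}. real L powr (- \<alpha>) * G k L x)" if "x \<in> cube d" for x
    using decay k that by blast
  have dep: "depends_only_on d ({k - L..k + L} \<inter> {1..d}) (G k L)"
    and sq: "square_integrable d (G k L)" and norm: "L2_norm d (G k L) \<le> g"
    and rank: "\<And>l. l \<in> {k - L..k + L} \<Longrightarrow>
      separation_rank d ({k - L..l} \<inter> {1..d}) ({l + 1..k + L} \<inter> {1..d}) (G k L) \<le> enat N"
    if "L \<in> {1..d}" for L
    using decay k that by blast+
  \<comment> \<open>The bound \<open>g\<close> dominates the norm of some interaction; \<open>k\<close> serves as a range known to be in
    \<open>{1..d}\<close>.\<close>
  have g: "0 \<le> g" using L2_norm_nonneg norm[OF k] by (rule order_trans)
  have split: "{1..d} = ({1..d} \<inter> {..R}) \<union> {R + 1..d}" by auto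
  have err: "f x k - h x = (\<Sum>L\<in>{R + 1..d}. real L powr (- \<alpha>) * G k L x)" if "x \<in> cube d" for x
    unfolding f[OF that] h_def by (subst split, subst sum.union_disjoint) auto
  note weighted = L2_norm_weighted_sum[of "{R + 1..d}" "\<lambda>L. real L powr (- \<alpha>)" d "G k" g
      "\<lambda>x. f x k - h x", OF _ _ _ _ g err]
  have "square_integrable d (\<lambda>x. f x k - h x)"
    by (rule weighted(1)) (use sq norm in auto)
  moreover have "L2_norm d (\<lambda>x. f x k - h x) \<le> \<epsilon>"
  proof (rule order_trans)
    show "L2_norm d (\<lambda>x. f x k - h x) \<le> (\<Sum>L\<in>{R + 1..d}. real L powr (- \<alpha>)) * g"
      by (rule weighted(2)) (use sq norm in auto)
    show "(\<Sum>L\<in>{R + 1..d}. real L powr (- \<alpha>)) * g \<le> \<epsilon>"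
      by (rule cutoff_error[OF assms(4,5) g X[unfolded X_def]]) simp
  qed
  moreover have "admits_TT d p \<Psi> h (\<lambda>_. N * R)"
  proof (rule separable_cuts_imp_admits_TT)
    show "1 \<le> d" using k by simp
    show "in_ansatz_space d p \<Psi> h"
      unfolding h_def using assms(3)[OF k] by (intro in_ansatz_space_sum) simp
    fix l
    have "cut_separable d l (N * card ({1..d} \<inter> {..R})) h"
      unfolding h_def
    proof (rule cut_separable_sum)
      fix L assume "L \<in> {1..d} \<inter> {..R}"
      then have L: "L \<in> {1..d}" by simp
      show "cut_separable d l N (\<lambda>x. real L powr (- \<alpha>) * G k L x)"
        by (rule cut_separable_scale, rule interaction_cut_separable[OF dep[OF L] rank[OF L]])
    qed simp
    moreover have "card ({1..d} \<inter> {..R}) \<le> card {1..R}"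
      by (rule card_mono) auto
    ultimately show "cut_separable d l (N * R) h"
      by (auto intro: cut_separable_mono)
  qed
  moreover have "tt_rank d (\<lambda>_. N * R) \<le> N * R"
    by (auto simp: tt_rank_def)
  ultimately show "\<exists>h r. square_integrable d (\<lambda>x. f x k - h x) \<and>
      L2_norm d (\<lambda>x. f x k - h x) \<le> \<epsilon> \<and> admits_TT d p \<Psi> h r \<and>
      tt_rank d r \<le> N * nat \<lceil>(\<alpha> / (\<alpha> - 1) * (g / \<epsilon>)) powr (1 / (\<alpha> - 1)) - 1\<rceil>"
    unfolding R_def X_def by blast
qed

end
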